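(* Let $S\subset\mathbb{Z}_{>0}$ be a finite nonempty set of positive integers and $m=\max(S)$. Then for every integer $n\ge m$, \[ D_S(n,q)=\sum_{k=0}^m a_k(S;q)\begin{bmatrix} n-m\\ k\end{bmatrix}_q, \] where $a_0(S;q)=0$ and for $k\ge 1$, \[ a_k(S;q)=\sum_{\substack{\pi\in A(S;m+k)\\ [m+1,m+k]\subset\{\pi_1,\ldots,\pi_m\}}} q^{\ell(\pi)} \in \mathbb{R}_{\geq 0}[q]. \]
   Context: For $\pi=\pi_1\cdots\pi_n\in\mathfrak{S}_n$ in one-line notation, $\mathrm{Des}(\pi)=\{i\in[n-1]: \pi_i>\pi_{i+1}\}$ and $\ell(\pi)=|\{(i,j): 1\le i<j\le n,\ \pi_i>\pi_j\}|$ is the number of inversions. $A(S;n)=\{\pi\in\mathfrak{S}_n:\mathrm{Des}(\pi)=S\}$ and $D_S(n,q)=\sum_{\pi\in A(S;n)}q^{\ell(\pi)}$. $[a,b]$ denotes $\{a,a+1,\ldots,b\}$. $[k]_q=1+q+\cdots+q^{k-1}$, $[k]!_q=[1]_q\cdots[k]_q$, and $\begin{bmatrix} n\\ k\end{bmatrix}_q=\frac{[n]!_q}{[n-k]!_q[k]!_q}$ for $0\le k\le n$, and $0$ if $k>n\ge 0$. *)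

theory Defs
  imports "HOL-Computational_Algebra.Polynomial" "HOL-Combinatorics.Permutations"
begin

text \<open>A permutation of \<open>{1..n}\<close> is a function \<open>p\<close> with \<open>p permutes {1..n}\<close>; its one-line notation is
  \<open>p 1, \<dots>, p n\<close>. The variable \<open>q\<close> is the formal indeterminate of \<^typ>\<open>real poly\<close>.\<close>

definition Des :: "nat \<Rightarrow> (nat \<Rightarrow> nat) \<Rightarrow> nat set" where
  "Des n p = {i \<in> {1..n-1}. p i > p (i + 1)}"

definition inv_count :: "nat \<Rightarrow> (nat \<Rightarrow> nat) \<Rightarrow> nat" where
  "inv_count n p = card {(i, j). 1 \<le> i \<and> i < j \<and> j \<le> n \<and> p i > p j}"

definition desc_class :: "nat set \<Rightarrow> nat \<Rightarrow> (nat \<Rightarrow> nat) set" where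
  "desc_class S n = {p. p permutes {1..n} \<and> Des n p = S}"

definition desc_poly :: "nat set \<Rightarrow> nat \<Rightarrow> real poly" where
  "desc_poly S n = (\<Sum>p\<in>desc_class S n. monom 1 (inv_count n p))"

definition qnum :: "nat \<Rightarrow> real poly" where
  "qnum k = (\<Sum>i<k. monom 1 i)"

definition qfact :: "nat \<Rightarrow> real poly" where
  "qfact k = (\<Prod>i=1..k. qnum i)"

text \<open>The division below is exact, see \<open>qbinom_mult_qfact\<close>.\<close>

definition qbinom :: "nat \<Rightarrow> nat \<Rightarrow> real poly" where
  "qbinom n k = (if k \<le> n then qfact n div (qfact (n - k) * qfact k) else 0)"

definition desc_coeff :: "nat set \<Rightarrow> nat \<Rightarrow> real poly" where
  "desc_coeff S k = (if k = 0 then 0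
     else \<Sum>p | p \<in> desc_class S (Max S + k) \<and> {Max S + 1..Max S + k} \<subseteq> p ` {1..Max S}.
            monom 1 (inv_count (Max S + k) p))"

lemma qnum_add: "qnum (j + k) = qnum j + monom 1 j * qnum k"
proof -
  have "(\<Sum>i<j + k. monom (1::real) i) = (\<Sum>i<j. monom 1 i) + (\<Sum>i<k. monom 1 (j + i))"
    by (induction k) (simp_all add: algebra_simps)
  then show ?thesis
    by (simp add: qnum_def sum_distrib_left mult_monom)
qed

lemma qfact_0 [simp]: "qfact 0 = 1"
  and qfact_Suc: "qfact (Suc n) = qnum (Suc n) * qfact n"
  by (simp_all add: qfact_def mult.commute)

lemma qfact_mult_dvd: "qfact j * qfact k dvd qfact (j + k)"
proof (induction "j + k" arbitrary: j k)
  case 0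
  then show ?case by simp
next
  case (Suc n)
  show ?case
  proof (cases "j = 0 \<or> k = 0")
    case True
    then show ?thesis by auto
  next
    case False
    then obtain j' k' where jk: "j = Suc j'" "k = Suc k'"
      by (metis not0_implies_Suc)
    have n: "n = j' + k" "n = j + k'"
      using Suc.hyps(2) jk by auto
    have "qfact j' * qfact k dvd qfact n" "qfact j * qfact k' dvd qfact n"
      using Suc.hyps(1)[OF n(1)] Suc.hyps(1)[OF n(2)] n by auto
    then have "qnum j * (qfact j' * qfact k) dvd qnum j * qfact n"
      and "qnum k * (qfact j * qfact k') dvd qnum k * qfact n"
      by (simp_all add: mult_dvd_mono)
    then have "qfact j * qfact k dvd qnum j * qfact n"
      and "qfact j * qfact k dvd qnum k * qfact n"
      by (simp_all add: jk qfact_Suc mult_ac)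
    moreover have "qfact (j + k) = qnum j * qfact n + monom 1 j * (qnum k * qfact n)"
      using Suc.hyps(2) qfact_Suc[of n] qnum_add[of j k] by (simp add: algebra_simps)
    ultimately show ?thesis
      by simp
  qed
qed

lemma qbinom_mult_qfact:
  "k \<le> n \<Longrightarrow> qbinom n k * (qfact (n - k) * qfact k) = qfact n"
  using qfact_mult_dvd[of "n - k" k] by (simp add: qbinom_def)

lemma qfact_nonzero: "qfact n \<noteq> 0"
proof -
  have "qnum (Suc i) \<noteq> 0" for i
  proof -
    have "coeff (qnum (Suc i)) 0 = 1"
      by (simp add: qnum_def coeff_sum sum.lessThan_Suc_shift del: sum.lessThan_Suc)
    then show ?thesis by auto
  qed
  then show ?thesis
    by (induction n) (simp_all add: qfact_Suc)
qed

end

theory Submission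
  imports Defs "HOL-Library.Infinite_Set"
begin

text \<open>Let \<open>m = Max S\<close>, let \<open>\<pi>\<close> be a permutation of \<open>{1..n}\<close> with descent set \<open>S\<close>, and let \<open>K\<close>, of size
  \<open>k\<close>, be the set of values above \<open>m\<close> among \<open>\<pi> 1, \<dots>, \<pi> m\<close>. If \<open>K\<close> were empty then \<open>\<pi> m \<le> m < \<pi> (m + 1)\<close>,
  contradicting the descent at \<open>m\<close>. Since \<open>\<pi>\<close> increases after position \<open>m\<close>, it factors uniquely as
  \<open>g \<circ> p\<close>, where \<open>g\<close> is the Grassmannian permutation of \<open>{m + 1..n}\<close> sending \<open>{m + 1..m + k}\<close> to \<open>K\<close> and
  \<open>p\<close> is one of the permutations of \<open>{1..m + k}\<close> counted by the \<open>k\<close>-th coefficient. Inversion numbers add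
  in this factorization, and the inversion generating function of the subsets \<open>K\<close> of size \<open>k\<close> is
  the \<open>q\<close>-binomial coefficient.\<close>

section \<open>The q-binomial coefficient as a generating function of subsets\<close>

definition cross_inv :: "nat set \<Rightarrow> nat set \<Rightarrow> nat" where
  "cross_inv A K = card {(x, y). x \<in> A - K \<and> y \<in> K \<and> x < y}"

lemma qbinom_0 [simp]: "qbinom n 0 = 1"
  using qfact_nonzero[of n] by (simp add: qbinom_def)

lemma qbinom_self [simp]: "qbinom n n = 1"
  using qfact_nonzero[of n] by (simp add: qbinom_def)

text \<open>This form of the q-Pascal rule puts the power of q on the term that lowers
  \<open>k\<close>. It matches the choice of whether a subset contains the largest element.\<close>

lemma qbinom_Suc_Suc:
  "qbinom (Suc n) (Suc k) = qbinom n (Suc k) + monom 1 (n - k) * qbinom n k"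
proof (cases "k < n")
  case False
  moreover from this have "qbinom n (Suc k) = 0" by (simp add: qbinom_def)
  ultimately show ?thesis
    by (cases "k = n") (auto simp: qbinom_def monom_0 one_pCons)
next
  case True
  \<comment> \<open>Multiplied by this common denominator, all three q-binomials become multiples of
    \<open>qfact n\<close>, and the claim reduces to splitting \<open>qnum (Suc n)\<close> after its
    first \<open>n - k\<close> terms.\<close>
  let ?d = "qfact (n - k) * qfact (Suc k)"
  have nk: "n - k = Suc (n - Suc k)" using True by simp
  have 1: "qbinom (Suc n) (Suc k) * ?d = qnum (Suc n) * qfact n"
    using qbinom_mult_qfact[of "Suc k" "Suc n"] True by (simp add: qfact_Suc)
  have "qbinom n (Suc k) * (qfact (n - Suc k) * qfact (Suc k)) = qfact n"
    using qbinom_mult_qfact[of "Suc k" n] True by simp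
  then have 2: "qbinom n (Suc k) * ?d = qnum (n - k) * qfact n"
    unfolding nk qfact_Suc[of "n - Suc k"] by (metis mult.assoc mult.left_commute)
  have "qbinom n k * (qfact (n - k) * qfact k) = qfact n"
    using qbinom_mult_qfact[of k n] True by simp
  then have 3: "qbinom n k * ?d = qnum (Suc k) * qfact n"
    unfolding qfact_Suc[of k] by (metis mult.assoc mult.left_commute)
  have "qnum (Suc n) = qnum (n - k) + monom 1 (n - k) * qnum (Suc k)"
    using qnum_add[of "n - k" "Suc k"] True by simp
  then have "qbinom (Suc n) (Suc k) * ?d
      = (qbinom n (Suc k) + monom 1 (n - k) * qbinom n k) * ?d"
    using 1 2 3 by (simp add: distrib_right mult.assoc)
  then show ?thesis
    using qfact_nonzero by simp
qed

text \<open>Outside the subset, a new largest element has no larger member to pair with. Inside it,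
  it pairs with each of the \<open>card A - card K\<close> nonmembers.\<close>

lemma cross_inv_insert_above:
  assumes "finite A" "K \<subseteq> A" "\<And>x. x \<in> A \<Longrightarrow> x < a"
  shows "cross_inv (insert a A) K = cross_inv A K"
    and "cross_inv (insert a A) (insert a K) = cross_inv A K + (card A - card K)"
proof -
  have a: "a \<notin> A" using assms(3) by blast
  have "{(x, y). x \<in> insert a A - K \<and> y \<in> K \<and> x < y} = {(x, y). x \<in> A - K \<and> y \<in> K \<and> x < y}"
    using assms(2,3) by (auto dest: less_asym)
  then show "cross_inv (insert a A) K = cross_inv A K"
    by (simp add: cross_inv_def)
  let ?X = "{(x, y). x \<in> A - K \<and> y \<in> K \<and> x < y}"
  have "{(x, y). x \<in> insert a A - insert a K \<and> y \<in> insert a K \<and> x < y} = ?X \<union> (A - K) \<times> {a}"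
    using a assms(3) by auto
  moreover have "?X \<inter> (A - K) \<times> {a} = {}" using a assms(2) by auto
  moreover have "finite ?X"
    by (rule finite_subset[of _ "A \<times> A"]) (use assms in auto)
  ultimately show "cross_inv (insert a A) (insert a K) = cross_inv A K + (card A - card K)"
    using assms by (simp add: cross_inv_def card_Un_disjoint card_cartesian_product
        card_Diff_subset finite_subset)
qed

text \<open>Induction on \<open>N\<close>: the subsets without and with the top element
  \<open>m + Suc N\<close> contribute the two terms of \<open>qbinom_Suc_Suc\<close>.\<close>

lemma sum_cross_inv_eq_qbinom:
  "(\<Sum>K | K \<subseteq> {m + 1..m + N} \<and> card K = k. monom 1 (cross_inv {m + 1..m + N} K)) = qbinom N k"
proof (induction N arbitrary: k)
  case 0
  have "{K. K \<subseteq> {m + 1..m + 0} \<and> card K = k} = (if k = 0 then {{}} else {})" by auto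
  then show ?case
    by (auto simp: cross_inv_def monom_0 qbinom_def)
next
  case (Suc N)
  let ?A = "{m + 1..m + N}" and ?a = "m + Suc N"
  have A': "{m + 1..m + Suc N} = insert ?a ?A" by auto
  have fin: "finite {K. K \<subseteq> ?A \<and> P K}" for P by (rule finite_subset[of _ "Pow ?A"]) auto
  show ?case
  proof (cases k)
    case 0
    have "{K. K \<subseteq> {m + 1..m + Suc N} \<and> card K = k} = {{}}"
      using 0 by (auto dest: finite_subset)
    then show ?thesis using 0 by (simp add: cross_inv_def monom_0)
  next
    case (Suc j)
    let ?P = "\<lambda>k. {K. K \<subseteq> ?A \<and> card K = k}"
    have split: "{K. K \<subseteq> {m + 1..m + Suc N} \<and> card K = k} = ?P (Suc j) \<union> insert ?a ` ?P j"
    proof (intro set_eqI iffI)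
      fix K assume K: "K \<in> {K. K \<subseteq> {m + 1..m + Suc N} \<and> card K = k}"
      then have "finite K" by (auto dest: finite_subset)
      show "K \<in> ?P (Suc j) \<union> insert ?a ` ?P j"
      proof (cases "?a \<in> K")
        case True
        then have "K = insert ?a (K - {?a})" by auto
        moreover have "K - {?a} \<in> ?P j"
          using K True \<open>finite K\<close> Suc by (auto simp: A')
        ultimately show ?thesis by blast
      next
        case False
        then have "K \<subseteq> ?A" using K unfolding A' by blast
        then show ?thesis using K Suc by simp
      qed
    next
      fix K assume K: "K \<in> ?P (Suc j) \<union> insert ?a ` ?P j"
      have "card (insert ?a L) = Suc (card L)" if "L \<subseteq> ?A" for L
        using that finite_subset[OF that] by (subst card_insert_disjoint) auto
      then show "K \<in> {K. K \<subseteq> {m + 1..m + Suc N} \<and> card K = k}"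
        using K Suc by (auto simp: A' simp del: card_insert_disjoint card.insert)
    qed
    have inj: "inj_on (insert ?a) (?P j)"
    proof (rule inj_onI)
      fix K L assume "K \<in> ?P j" "L \<in> ?P j" "insert ?a K = insert ?a L"
      moreover from this have "?a \<notin> K" "?a \<notin> L" by auto
      ultimately show "K = L" by (simp add: insert_ident)
    qed
    have disj: "?P (Suc j) \<inter> insert ?a ` ?P j = {}" by auto
    have cross: "cross_inv (insert ?a ?A) K = cross_inv ?A K"
      "cross_inv (insert ?a ?A) (insert ?a K) = cross_inv ?A K + (N - card K)" if "K \<subseteq> ?A" for K
      using cross_inv_insert_above[of ?A K ?a] that by auto
    let ?f = "\<lambda>K. monom (1::real) (cross_inv (insert ?a ?A) K)"
    have "sum ?f (?P (Suc j)) = qbinom N (Suc j)"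
      unfolding Suc.IH[symmetric]
      by (rule sum.cong) (use cross(1) in auto)
    moreover have "sum ?f (insert ?a ` ?P j) = monom 1 (N - j) * qbinom N j"
    proof -
      have "sum ?f (insert ?a ` ?P j)
          = (\<Sum>K\<in>?P j. monom 1 (N - j) * monom 1 (cross_inv ?A K))"
        unfolding sum.reindex[OF inj]
        by (rule sum.cong) (use cross(2) in \<open>auto simp: mult_monom add.commute\<close>)
      then show ?thesis unfolding Suc.IH[symmetric] sum_distrib_left .
    qed
    moreover have "sum ?f (?P (Suc j) \<union> insert ?a ` ?P j)
        = sum ?f (?P (Suc j)) + sum ?f (insert ?a ` ?P j)"
      by (rule sum.union_disjoint) (use fin disj in auto)
    ultimately show ?thesis
      unfolding split unfolding A' by (simp add: Suc qbinom_Suc_Suc)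
  qed
qed

section \<open>Increasing tails of permutations\<close>

lemma strict_mono_on_tail_fixed:
  fixes p :: "nat \<Rightarrow> nat"
  assumes mono: "strict_mono_on {a..n} p" and im: "p ` {a..n} \<subseteq> {..n}"
    and surj: "{b..n} \<subseteq> p ` {a..n}" and i: "a \<le> i" "b \<le> i" "i \<le> n"
  shows "p i = i"
proof (rule ccontr)
  assume "p i \<noteq> i"
  have inj: "inj_on p {a..n}" using mono strict_mono_on_imp_inj_on by blast
  consider "p i > i" | "p i < i" using \<open>p i \<noteq> i\<close> by linarith
  then show False
  proof cases
    case 1
    \<comment> \<open>The positions from \<open>i\<close> on would be squeezed into one value too
      few.\<close>
    have "p ` {i..n} \<subseteq> {i + 1..n}"
    proof
      fix y assume "y \<in> p ` {i..n}"
      then obtain j where j: "i \<le> j" "j \<le> n" "y = p j" by auto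
      then have "p i \<le> p j"
        using strict_mono_onD[OF mono, of i j] i by (cases "i = j") auto
      moreover have "p j \<in> {..n}" using im j i by (auto simp: image_subset_iff)
      ultimately show "y \<in> {i + 1..n}" using 1 j by auto
    qed
    then have "card (p ` {i..n}) \<le> card {i + 1..n}" by (intro card_mono) auto
    moreover have "card (p ` {i..n}) = card {i..n}"
      by (rule card_image, rule inj_on_subset[OF inj]) (use i in auto)
    ultimately show False using i by simp
  next
    case 2
    \<comment> \<open>Since \<open>b \<le> i\<close>, every value from \<open>i\<close> on is
      attained, but only positions after \<open>i\<close> can attain it: one position too
      few.\<close>
    have "{i..n} \<subseteq> p ` {i + 1..n}"
    proof
      fix y assume y: "y \<in> {i..n}"
      then have "y \<in> p ` {a..n}" using surj i by auto
      then obtain j where j: "j \<in> {a..n}" "y = p j" by auto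
      have "i < j"
      proof (rule ccontr)
        assume "\<not> i < j"
        then have "p j \<le> p i" using strict_mono_onD[OF mono, of j i] i j by (cases "i = j") auto
        then show False using 2 y j by auto
      qed
      then show "y \<in> p ` {i + 1..n}" using j by auto
    qed
    then have "card {i..n} \<le> card {i + 1..n}"
      using surj_card_le[of "{i + 1..n}" "{i..n}" p] by simp
    then show False using i by simp
  qed
qed

lemma desc_class_increasing:
  assumes "p \<in> desc_class S n" "\<And>s. s \<in> S \<Longrightarrow> s \<le> m"
  shows "strict_mono_on {m + 1..n} p"
proof (rule strict_mono_onI)
  fix i j assume ij: "i \<in> {m + 1..n}" "j \<in> {m + 1..n}" "i < j"
  have p: "p permutes {1..n}" "Des n p = S" using assms by (auto simp: desc_class_def)
  have "Suc i \<le> j" using ij by simp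
  then show "p i < p j" using ij(2)
  proof (induction j rule: dec_induct)
    case base
    have "i \<notin> Des n p" using p assms(2)[of i] ij by auto
    then have "p i \<le> p (Suc i)" using base ij(1) by (auto simp: Des_def)
    moreover have "p i \<noteq> p (Suc i)" using permutes_inj[OF p(1)] by (auto simp: inj_eq)
    ultimately show ?case by simp
  next
    case (step j)
    have "j \<notin> Des n p" using p assms(2)[of j] ij step by auto
    then have "p j \<le> p (Suc j)" using step ij(1) by (auto simp: Des_def)
    then show ?case using step ij(1) by auto
  qed
qed

section \<open>Grassmannian permutations and the factorization\<close>

text \<open>Apart from fixing \<open>{1..m}\<close>, \<open>g\<close> is the permutation of \<open>{m + 1..n}\<close> listing \<open>K\<close> and then its
  complement, each in increasing order; its inversions are counted by \<^const>\<open>cross_inv\<close>.\<close>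

locale grassmannian =
  fixes m k n :: nat and K :: "nat set" and g :: "nat \<Rightarrow> nat"
  assumes g_permutes: "g permutes {m + 1..n}"
    and g_image: "g ` {m + 1..m + k} = K"
    and g_mono_lo: "strict_mono_on {m + 1..m + k} g"
    and g_mono_hi: "strict_mono_on {m + k + 1..n} g"
    and mk_le: "m + k \<le> n"

lemma grassmannian_exists:
  assumes "K \<subseteq> {m + 1..n}" "m \<le> n"
  shows "\<exists>g. grassmannian m (card K) n K g"
proof -
  let ?k = "card K" and ?C = "{m + 1..n} - K"
  have finK: "finite K" using assms(1) finite_subset by blast
  have cardK: "card K \<le> n - m" using card_mono[OF _ assms(1)] by simp
  obtain h where h: "bij_betw h {..<?k} K" "strict_mono_on {..<?k} h"
    by (rule ex_bij_betw_strict_mono_card[OF finK])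
  have cardC: "card ?C = n - m - ?k"
    using assms(1) finK by (simp add: card_Diff_subset)
  obtain h' where h': "bij_betw h' {..<n - m - ?k} ?C" "strict_mono_on {..<n - m - ?k} h'"
    by (rule ex_bij_betw_strict_mono_card[of ?C, unfolded cardC]) simp
  \<comment> \<open>The shifts by \<open>m + 1\<close> and \<open>m + ?k + 1\<close> move the start
    of each block to 0, where the increasing enumerations of \<open>K\<close> and of its complement
    begin.\<close>
  define g where "g i = (if i \<in> {m + 1..m + ?k} then h (i - (m + 1))
     else if i \<in> {m + ?k + 1..n} then h' (i - (m + ?k + 1)) else i)" for i
  have b1: "bij_betw g {m + 1..m + ?k} K"
  proof -
    have "bij_betw (\<lambda>i. i - (m + 1)) {m + 1..m + ?k} {..<?k}"
      by (rule bij_betwI[where g = "\<lambda>i. i + (m + 1)"]) auto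
    from bij_betw_trans[OF this h(1)] show ?thesis
      by (rule bij_betw_cong[THEN iffD1, rotated]) (auto simp: g_def)
  qed
  have b2: "bij_betw g {m + ?k + 1..n} ?C"
  proof -
    have "bij_betw (\<lambda>i. i - (m + ?k + 1)) {m + ?k + 1..n} {..<n - m - ?k}"
      by (rule bij_betwI[where g = "\<lambda>i. i + (m + ?k + 1)"]) auto
    from bij_betw_trans[OF this h'(1)] show ?thesis
      by (rule bij_betw_cong[THEN iffD1, rotated]) (auto simp: g_def)
  qed
  have "bij_betw g ({m + 1..m + ?k} \<union> {m + ?k + 1..n}) (K \<union> ?C)"
    by (rule bij_betw_combine[OF b1 b2]) auto
  moreover have "{m + 1..m + ?k} \<union> {m + ?k + 1..n} = {m + 1..n}" "K \<union> ?C = {m + 1..n}"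
    using assms cardK by auto
  ultimately have "g permutes {m + 1..n}"
    by (intro bij_imp_permutes) (use cardK assms in \<open>auto simp: g_def\<close>)
  moreover have "strict_mono_on {m + 1..m + ?k} g"
    by (rule strict_mono_onI) (auto simp: g_def intro!: strict_mono_onD[OF h(2)])
  moreover have "strict_mono_on {m + ?k + 1..n} g"
    by (rule strict_mono_onI) (auto simp: g_def intro!: strict_mono_onD[OF h'(2)])
  ultimately have "grassmannian m ?k n K g"
    using b1 cardK assms by (simp add: grassmannian_def bij_betw_def)
  then show ?thesis by blast
qed

context grassmannian
begin

lemma g_low: "i \<le> m \<Longrightarrow> g i = i"
  using g_permutes by (simp add: permutes_not_in)

lemma g_high: "m < i \<Longrightarrow> i \<le> n \<Longrightarrow> m < g i"
  using permutes_in_image[OF g_permutes, of i] by auto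

text \<open>Together with \<open>g_less_skip\<close> this confines the inversions of
  \<open>g\<close> to pairs with one position in \<open>{m + 1..m + k}\<close> and the other in
  \<open>{m + k + 1..n}\<close>.\<close>

lemma g_less_iff:
  assumes "i \<le> m + k" "j \<le> m + k"
  shows "g i < g j \<longleftrightarrow> i < j"
proof -
  have "g i < g j" if "i < j" "j \<le> m + k" for i j
    using that g_low[of i] g_low[of j] g_high[of j] mk_le strict_mono_onD[OF g_mono_lo, of i j]
    by (cases "i \<le> m"; cases "j \<le> m") auto
  then show ?thesis using assms by (metis less_asym less_irrefl nat_neq_iff)
qed

lemma g_less_skip:
  assumes "i < j" "i \<in> {..m} \<union> {m + k + 1..n}" "j \<in> {..m} \<union> {m + k + 1..n}"
  shows "g i < g j"
  using assms g_low[of i] g_low[of j] g_high[of j] strict_mono_onD[OF g_mono_hi, of i j]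
  by (cases "i \<le> m"; cases "j \<le> m") auto

text \<open>The values above \<open>m\<close> are all used up by the first \<open>m\<close>
  positions, and \<open>p\<close> is injective.\<close>

lemma tail_value_le:
  assumes "p permutes {1..m + k}" "{m + 1..m + k} \<subseteq> p ` {1..m}" "m < i" "i \<le> m + k"
  shows "p i \<le> m"
proof (rule ccontr)
  assume "\<not> p i \<le> m"
  moreover have "p i \<in> {1..m + k}" using assms permutes_in_image[OF assms(1), of i] by auto
  ultimately have "p i \<in> p ` {1..m}" using assms(2) by (auto simp: subset_iff)
  then show False using permutes_inj[OF assms(1)] assms(3) by (auto simp: inj_eq)
qed

lemma Des_comp:
  assumes p: "p permutes {1..m + k}" "{m + 1..m + k} \<subseteq> p ` {1..m}" and "0 < k"
  shows "Des n (g \<circ> p) = Des (m + k) p"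
proof -
  have le: "p i \<le> m + k" if "i \<le> m + k" for i
    using permutes_in_image[OF p(1), of i] permutes_not_in[OF p(1), of i] that
    by (cases "i = 0") auto
  have fix_: "p i = i" if "m + k < i" for i
    using permutes_not_in[OF p(1)] that by auto
  have "(g \<circ> p) i > (g \<circ> p) (i + 1) \<longleftrightarrow> i < m + k \<and> p i > p (i + 1)"
    if "1 \<le> i" "i \<le> n - 1" for i
  proof -
    consider "i < m + k" | "i = m + k" | "m + k < i" by linarith
    then show ?thesis
    proof cases
      case 1
      then show ?thesis using g_less_iff[of "p (i + 1)" "p i"] le[of i] le[of "i + 1"] by simp
    next
      case 2
      \<comment> \<open>The junction of the two ranges: \<open>0 < k\<close> puts position
        \<open>m + k\<close> beyond \<open>m\<close>, so its value is at most \<open>m\<close>.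
        Hence \<open>g\<close> fixes that value and keeps it below \<open>g (i + 1)\<close>.\<close>
      then have "p i \<le> m" using tail_value_le[OF p, of i] \<open>0 < k\<close> by simp
      have "i + 1 \<le> n" using that by simp
      then have "g (p i) < g (i + 1)"
        using 2 \<open>p i \<le> m\<close> by (intro g_less_skip) auto
      then show ?thesis using 2 fix_[of "i + 1"] by simp
    next
      case 3
      have "i + 1 \<le> n" using that by simp
      then have "g i < g (i + 1)" using 3 by (intro g_less_skip) auto
      then show ?thesis using 3 fix_[of i] fix_[of "i + 1"] by simp
    qed
  qed
  then show ?thesis
    using mk_le by (auto simp: Des_def)
qed

lemma image_comp_Int:
  assumes p: "p permutes {1..m + k}" "{m + 1..m + k} \<subseteq> p ` {1..m}"
  shows "(g \<circ> p) ` {1..m} \<inter> {m + 1..n} = K"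
proof -
  have "p ` {1..m} \<subseteq> {1..m + k}" using permutes_image[OF p(1)] by auto
  then have "p ` {1..m} = (p ` {1..m} \<inter> {1..m}) \<union> {m + 1..m + k}" using p(2) by auto
  then have "(g \<circ> p) ` {1..m} = g ` (p ` {1..m} \<inter> {1..m}) \<union> K"
    using g_image by (metis image_Un image_comp)
  moreover have "g ` (p ` {1..m} \<inter> {1..m}) \<inter> {m + 1..n} = {}"
    using g_low by auto
  moreover have "K \<subseteq> {m + 1..n}"
    using image_mono[of "{m + 1..m + k}" "{m + 1..n}" g] g_image mk_le permutes_image[OF g_permutes]
    by simp
  ultimately show ?thesis by blast
qed

text \<open>Pairs of positions up to \<open>m + k\<close> give the inversions of \<open>p\<close>,
  and pairs beyond give none. Composing with \<open>p\<close> only rearranges the left positions of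
  the mixed pairs, so their number depends on \<open>K\<close> alone.\<close>

lemma inv_count_comp:
  assumes p: "p permutes {1..m + k}"
  shows "inv_count n (g \<circ> p) = inv_count (m + k) p + cross_inv {m + 1..n} K"
proof -
  have le: "1 \<le> p i \<and> p i \<le> m + k" if "1 \<le> i" "i \<le> m + k" for i
    using permutes_in_image[OF p, of i] that by auto
  have fix_: "p i = i" if "m + k < i" for i
    using permutes_not_in[OF p] that by auto
  have inj_g: "inj g" and inj_p: "inj p" using g_permutes p permutes_inj by auto
  let ?I = "\<lambda>n p. {(i, j). 1 \<le> i \<and> i < j \<and> j \<le> n \<and> p i > (p j::nat)}"
  let ?X = "{(i, j). 1 \<le> i \<and> i \<le> m + k \<and> m + k < j \<and> j \<le> n \<and> g (p i) > g j}"
  let ?Y = "{(x, y). x \<in> {m + 1..n} - K \<and> y \<in> K \<and> x < y}"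
  have "?I n (g \<circ> p) = ?I (m + k) p \<union> ?X"
  proof (intro set_eqI iffI)
    fix z assume z: "z \<in> ?I n (g \<circ> p)"
    obtain i j where [simp]: "z = (i, j)" by fastforce
    have ij: "1 \<le> i" "i < j" "j \<le> n" "g (p i) > g (p j)" using z by auto
    show "z \<in> ?I (m + k) p \<union> ?X"
    proof (cases "j \<le> m + k")
      case True
      then show ?thesis using ij g_less_iff[of "p j" "p i"] le[of i] le[of j] by simp
    next
      case False
      then have "i \<le> m + k"
        using ij fix_[of i] fix_[of j] g_less_skip[of i j] by fastforce
      then show ?thesis using ij False fix_[of j] by simp
    qed
  next
    fix z assume "z \<in> ?I (m + k) p \<union> ?X"
    then show "z \<in> ?I n (g \<circ> p)"
      using mk_le le g_less_iff fix_ by (auto simp: less_le_trans)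
  qed
  moreover have "?I (m + k) p \<inter> ?X = {}" by auto
  moreover have "finite (?I (m + k) p)"
    by (rule finite_subset[of _ "{..m + k} \<times> {..m + k}"]) auto
  moreover have "finite ?X"
    by (rule finite_subset[of _ "{..n} \<times> {..n}"]) (use mk_le in auto)
  ultimately have "inv_count n (g \<circ> p) = inv_count (m + k) p + card ?X"
    unfolding inv_count_def by (simp add: card_Un_disjoint)
  \<comment> \<open>A mixed inversion is recorded by its two values, the smaller one first: a
    nonmember of \<open>K\<close> and a larger member.\<close>
  moreover have "bij_betw (\<lambda>(i, j). (g j, g (p i))) ?X ?Y"
    unfolding bij_betw_def
  proof (intro conjI set_eqI iffI)
    show "inj_on (\<lambda>(i, j). (g j, g (p i))) ?X"
      by (rule inj_onI) (auto simp: inj_eq[OF inj_g] inj_eq[OF inj_p])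
  next
    fix z assume "z \<in> (\<lambda>(i, j). (g j, g (p i))) ` ?X"
    then obtain i j where z: "z = (g j, g (p i))"
      and ij: "1 \<le> i" "i \<le> m + k" "m + k < j" "j \<le> n" "g (p i) > g j" by auto
    have j: "g j \<in> {m + 1..n}" using permutes_in_image[OF g_permutes, of j] ij by auto
    have "g j \<notin> K"
      using g_image inj_g ij by (auto simp: inj_eq)
    \<comment> \<open>If \<open>p i\<close> were at most \<open>m\<close>, then \<open>g\<close>
      would fix it, leaving it below \<open>g j\<close>.\<close>
    moreover have "p i > m" using ij j g_low[of "p i"] by fastforce
    then have "g (p i) \<in> K" using g_image le[of i] ij by auto
    ultimately show "z \<in> ?Y" using z j ij by auto
  next
    fix z assume "z \<in> ?Y"
    then obtain x y where z: "z = (x, y)" and xy: "x \<in> {m + 1..n}" "x \<notin> K" "y \<in> K" "x < y"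
      by auto
    obtain j where j: "j \<in> {m + 1..n}" "x = g j"
      using xy(1) permutes_image[OF g_permutes] by (metis imageE)
    then have "m + k < j" using xy(2) g_image by fastforce
    obtain v where v: "v \<in> {m + 1..m + k}" "y = g v" using xy(3) g_image by auto
    then have "v \<in> p ` {1..m + k}" unfolding permutes_image[OF p] by simp
    then obtain i where i: "i \<in> {1..m + k}" "v = p i" by blast
    show "z \<in> (\<lambda>(i, j). (g j, g (p i))) ` ?X"
      by (rule image_eqI[of _ _ "(i, j)"]) (use z i j v xy \<open>m + k < j\<close> in auto)
  qed
  then have "card ?X = card ?Y" by (rule bij_betw_same_card)
  ultimately show ?thesis by (simp add: cross_inv_def)
qed

text \<open>Only surjectivity takes work: undoing \<open>g\<close> must leave a permutation that
  moves nothing beyond \<open>m + k\<close>.\<close>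

lemma bij_betw_desc_class:
  assumes S: "\<And>s. s \<in> S \<Longrightarrow> s \<le> m" and "0 < k"
  shows "bij_betw (\<lambda>p. g \<circ> p)
     {p \<in> desc_class S (m + k). {m + 1..m + k} \<subseteq> p ` {1..m}}
     {p \<in> desc_class S n. p ` {1..m} \<inter> {m + 1..n} = K}"
    (is "bij_betw ?c ?B ?A")
  unfolding bij_betw_def
proof (intro conjI set_eqI iffI)
  show "inj_on ?c ?B"
    by (rule inj_onI) (simp add: fun_eq_iff inj_eq[OF permutes_inj[OF g_permutes]])
next
  fix w assume "w \<in> ?c ` ?B"
  then obtain p where w: "w = g \<circ> p" and p: "p permutes {1..m + k}" "Des (m + k) p = S"
     "{m + 1..m + k} \<subseteq> p ` {1..m}" by (auto simp: desc_class_def)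
  have "p permutes {1..n}" using p(1) mk_le by (auto intro: permutes_subset)
  moreover have "g permutes {1..n}" using g_permutes by (auto intro: permutes_subset)
  ultimately have "w permutes {1..n}" unfolding w by (rule permutes_compose)
  then show "w \<in> ?A"
    using w Des_comp[OF p(1,3) \<open>0 < k\<close>] image_comp_Int[OF p(1,3)] p(2) by (simp add: desc_class_def)
next
  fix w assume w: "w \<in> ?A"
  then have wp: "w permutes {1..n}" and wK: "w ` {1..m} \<inter> {m + 1..n} = K"
    by (auto simp: desc_class_def)
  have w_mono: "strict_mono_on {m + 1..n} w"
    using w S desc_class_increasing by blast
  let ?p = "inv g \<circ> w"
  have gp: "g (?p i) = w i" for i using permutes_inverses(1)[OF g_permutes] by simp
  then have comp: "g \<circ> ?p = w" by auto
  have g1: "g permutes {1..n}" using g_permutes by (auto intro: permutes_subset)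
  have pp: "?p permutes {1..n}"
    by (rule permutes_compose[OF wp permutes_inv[OF g1]])
  have img: "{m + 1..m + k} \<subseteq> ?p ` {1..m}"
  proof
    fix v assume v: "v \<in> {m + 1..m + k}"
    then have "g v \<in> w ` {1..m}" using g_image wK by blast
    then obtain i where "i \<in> {1..m}" "g v = w i" by auto
    then show "v \<in> ?p ` {1..m}"
      using permutes_inverses(2)[OF g_permutes, of v] by force
  qed
  \<comment> \<open>The values \<open>m + 1\<close> to \<open>m + k\<close> already occur in the
    first \<open>m\<close> positions. On the values left for the tail \<open>g\<close> preserves
    order, so the increase of \<open>w\<close> passes to \<open>?p\<close>.\<close>
  have range: "?p i \<in> {..m} \<union> {m + k + 1..n}" if "i \<in> {m + 1..n}" for i
  proof (rule ccontr)
    assume "\<not> ?thesis"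
    moreover have "?p i \<in> {1..n}" using permutes_in_image[OF pp, of i] that by auto
    ultimately have "?p i \<in> {m + 1..m + k}" by auto
    then obtain j where "j \<in> {1..m}" "?p i = ?p j" using img by blast
    then show False using permutes_inj[OF pp] that by (metis atLeastAtMost_iff injD not_less_eq_eq order_trans Suc_eq_plus1)
  qed
  have "strict_mono_on {m + 1..n} ?p"
  proof (rule strict_mono_onI)
    fix i j assume ij: "i \<in> {m + 1..n}" "j \<in> {m + 1..n}" "i < j"
    then have "g (?p i) < g (?p j)" unfolding gp by (rule strict_mono_onD[OF w_mono])
    then show "?p i < ?p j"
      using g_less_skip[of "?p j" "?p i"] range ij by (metis less_asym less_irrefl nat_neq_iff)
  qed
  moreover have "?p ` {m + 1..n} \<subseteq> {..n}" using range mk_le by fastforce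
  moreover have "{m + k + 1..n} \<subseteq> ?p ` {m + 1..n}"
  proof
    fix v assume v: "v \<in> {m + k + 1..n}"
    then have "v \<in> ?p ` {1..n}" using permutes_image[OF pp] by auto
    then obtain i where i: "i \<in> {1..n}" "v = ?p i" by auto
    have "\<not> i \<le> m"
    proof
      assume "i \<le> m"
      have "w i = g v" using i gp by simp
      moreover have "g v \<in> {m + 1..n}" using permutes_in_image[OF g_permutes, of v] v by auto
      ultimately have "g v \<in> K" using wK \<open>i \<le> m\<close> i by (metis IntI atLeastAtMost_iff imageI)
      then obtain u where "u \<in> {m + 1..m + k}" "g v = g u" using g_image by auto
      then show False using v permutes_inj[OF g_permutes] by (auto simp: inj_eq)
    qed
    then show "v \<in> ?p ` {m + 1..n}" using i by auto
  qed
  \<comment> \<open>The tail of \<open>?p\<close> increases and attains every value beyond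
    \<open>m + k\<close>, so by counting it must fix all of them.\<close>
  ultimately have "?p i = i" if "m + k < i" "i \<le> n" for i
    using strict_mono_on_tail_fixed[of "m + 1" n ?p "m + k + 1" i] that by simp
  then have "?p permutes {1..m + k}"
    by (intro permutes_superset[OF pp]) auto
  moreover from this have "Des (m + k) ?p = S"
    using Des_comp[OF _ img \<open>0 < k\<close>] comp w by (simp add: desc_class_def)
  ultimately have "?p \<in> ?B" using img by (simp add: desc_class_def)
  then show "w \<in> ?c ` ?B" using comp by (metis (no_types, lifting) image_eqI)
qed

end

section \<open>Fibres over the set of large values, and the summation\<close>

lemma finite_desc_class [simp]: "finite (desc_class S n)"
  by (rule finite_subset[of _ "{p. p permutes {1..n}}"])
    (auto simp: desc_class_def finite_permutations)

lemma sum_desc_class_fiber: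
  assumes S: "\<And>s. s \<in> S \<Longrightarrow> s \<le> Max S" "Max S \<in> S" "Max S > 0"
    and "Max S \<le> n" "K \<subseteq> {Max S + 1..n}"
  shows "(\<Sum>p | p \<in> desc_class S n \<and> p ` {1..Max S} \<inter> {Max S + 1..n} = K.
       monom 1 (inv_count n p))
     = desc_coeff S (card K) * monom 1 (cross_inv {Max S + 1..n} K)"
proof (cases "K = {}")
  case True
  have "{p \<in> desc_class S n. p ` {1..Max S} \<inter> {Max S + 1..n} = {}} = {}"
  proof (rule ccontr)
    let ?m = "Max S"
    assume "\<not> ?thesis"
    then obtain p where p: "p permutes {1..n}" "Des n p = S" "p ` {1..?m} \<inter> {?m + 1..n} = {}"
      by (auto simp: desc_class_def)
    have "p ` {1..?m} \<subseteq> {1..n}" using permutes_image[OF p(1)] \<open>?m \<le> n\<close> by auto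
    \<comment> \<open>With no large value among them, the first \<open>?m\<close> positions hold
      exactly \<open>1\<close> to \<open>?m\<close>. The descent at \<open>?m\<close> would then
      force a repeated value, so the fibre is empty, in agreement with
      \<open>desc_coeff S 0 = 0\<close>.\<close>
    then have sub: "p ` {1..?m} \<subseteq> {1..?m}" using p(3) by fastforce
    moreover have "card (p ` {1..?m}) = card {1..?m}"
      by (rule card_image, rule inj_on_subset[OF permutes_inj[OF p(1)]]) auto
    ultimately have eq: "p ` {1..?m} = {1..?m}" by (intro card_subset_eq) auto
    have "?m \<in> Des n p" using p S by simp
    then have m: "p ?m > p (?m + 1)" "?m + 1 \<le> n" by (auto simp: Des_def)
    have "p ?m \<in> {1..?m}" using eq S(3) by auto
    moreover have "p (?m + 1) \<in> {1..n}" using permutes_in_image[OF p(1), of "?m + 1"] m by auto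
    ultimately have "p (?m + 1) \<in> p ` {1..?m}" using m eq by auto
    then show False using permutes_inj[OF p(1)] by (auto simp: inj_eq)
  qed
  then show ?thesis using True by (simp only:) (simp add: desc_coeff_def)
next
  case False
  let ?m = "Max S" and ?k = "card K"
  have "finite K" using assms(5) finite_subset by blast
  then have k: "0 < ?k" using False by (simp add: card_gt_0_iff)
  obtain g where "grassmannian ?m ?k n K g"
    using grassmannian_exists assms by blast
  then interpret grassmannian ?m ?k n K g .
  let ?B = "{p \<in> desc_class S (?m + ?k). {?m + 1..?m + ?k} \<subseteq> p ` {1..?m}}"
  let ?A = "{p \<in> desc_class S n. p ` {1..?m} \<inter> {?m + 1..n} = K}"
  have "(\<Sum>p\<in>?A. monom (1::real) (inv_count n p)) = (\<Sum>p\<in>?B. monom 1 (inv_count n (g \<circ> p)))"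
    using sum.reindex_bij_betw[OF bij_betw_desc_class[OF S(1) k], symmetric] by simp
  also have "\<dots> = (\<Sum>p\<in>?B. monom 1 (inv_count (?m + ?k) p) * monom 1 (cross_inv {?m + 1..n} K))"
    by (rule sum.cong) (auto simp: desc_class_def inv_count_comp mult_monom)
  also have "\<dots> = desc_coeff S ?k * monom 1 (cross_inv {?m + 1..n} K)"
    using k by (simp add: desc_coeff_def sum_distrib_right)
  finally show ?thesis .
qed

text \<open>Too few positions for \<open>k\<close> prescribed values; this lets the final sum stop
  at \<open>m\<close> for every \<open>n\<close>.\<close>

lemma desc_coeff_eq_0:
  assumes "k > Max S"
  shows "desc_coeff S k = 0"
proof -
  have "\<not> {Max S + 1..Max S + k} \<subseteq> p ` {1..Max S}" for p :: "nat \<Rightarrow> nat"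
  proof
    assume "{Max S + 1..Max S + k} \<subseteq> p ` {1..Max S}"
    then have "card {Max S + 1..Max S + k} \<le> card {1..Max S}"
      by (intro surj_card_le) auto
    then show False using assms by simp
  qed
  then show ?thesis by (simp add: desc_coeff_def)
qed

theorem theorem2p1:
  fixes S :: "nat set" and m :: nat
  assumes "finite S" and "S \<noteq> {}" and "\<forall>s\<in>S. s > 0" and "m = Max S"
  shows "(\<forall>n\<ge>m. desc_poly S n = (\<Sum>k=0..m. desc_coeff S k * qbinom (n - m) k)) \<and>
         (\<forall>k i. coeff (desc_coeff S k) i \<ge> 0)"
proof (intro conjI allI impI)
  fix k i
  show "coeff (desc_coeff S k) i \<ge> 0"
    by (auto simp: desc_coeff_def coeff_sum intro!: sum_nonneg)
next
  fix n assume n: "m \<le> n"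
  have m: "m \<in> S" "m > 0" "\<And>s. s \<in> S \<Longrightarrow> s \<le> m" using assms by auto
  let ?U = "{m + 1..n}"
  let ?w = "\<lambda>K. monom (1::real) (cross_inv ?U K)"
  have "desc_poly S n = (\<Sum>K\<in>Pow ?U. \<Sum>p | p \<in> desc_class S n \<and> p ` {1..m} \<inter> ?U = K.
      monom 1 (inv_count n p))"
    unfolding desc_poly_def by (rule sum.group[symmetric]) auto
  also have "\<dots> = (\<Sum>K\<in>Pow ?U. desc_coeff S (card K) * ?w K)"
    using sum_desc_class_fiber[of S n] m n unfolding assms(4) by (intro sum.cong) auto
  \<comment> \<open>Fibres depend on \<open>K\<close> only through its size and
    \<open>cross_inv\<close>, so subsets are grouped by size. The bound \<open>n\<close> is a coarse
    one that also contains \<open>{0..m}\<close>.\<close>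
  also have "\<dots> = (\<Sum>k\<in>{0..n}. \<Sum>K | K \<in> Pow ?U \<and> card K = k. desc_coeff S (card K) * ?w K)"
  proof (rule sum.group[symmetric])
    show "card ` Pow ?U \<subseteq> {0..n}"
    proof
      fix c assume "c \<in> card ` Pow ?U"
      then obtain K where "K \<subseteq> ?U" "c = card K" by auto
      then show "c \<in> {0..n}" using card_mono[of ?U K] by simp
    qed
  qed auto
  also have "\<dots> = (\<Sum>k\<in>{0..n}. desc_coeff S k * qbinom (n - m) k)"
  proof (rule sum.cong)
    fix k
    have "(\<Sum>K | K \<in> Pow ?U \<and> card K = k. ?w K) = qbinom (n - m) k"
      using sum_cross_inv_eq_qbinom[of m "n - m" k] n by simp
    then show "(\<Sum>K | K \<in> Pow ?U \<and> card K = k. desc_coeff S (card K) * ?w K)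
        = desc_coeff S k * qbinom (n - m) k"
      by (simp flip: sum_distrib_left)
  qed simp
  also have "\<dots> = (\<Sum>k=0..m. desc_coeff S k * qbinom (n - m) k)"
    by (rule sum.mono_neutral_right) (use n desc_coeff_eq_0 assms(4) in auto)
  finally show "desc_poly S n = (\<Sum>k=0..m. desc_coeff S k * qbinom (n - m) k)" .
qed

end
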